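(* One has the orthogonal decomposition $$L^2(\Omega)=\bigoplus_{n=0}^\infty \mathcal{H}_n,$$ where $\bigoplus_{n=0}^\infty\mathcal{H}_n$ denotes the completion (closure) in $L^2(\Omega)$ of the linear span $\mathcal{S}$ of $\bigcup_{n\ge 0}\mathcal{H}_n$.
   Context: $\mathbb{N}=\{0,1,2,\ldots\}$. Let $(p_k)_{k\in\mathbb{N}}$ be a deterministic sequence in $(0,1)$ and $q_k=1-p_k$. Let $\Omega=\{-1,1\}^{\mathbb{N}}$ with its product $\sigma$-algebra, let $X_k:\Omega\to\{-1,1\}$ be the canonical projections, and let $\mathbb{P}$ be the product probability measure under which the $X_k$ are independent with $\mathbb{P}(X_k=1)=p_k$, $\mathbb{P}(X_k=-1)=q_k$. Set $Y_k=\frac{q_k-p_k+X_k}{2\sqrt{p_kq_k}}$, so that $E[Y_k]=0$ and $E[Y_k^2]=1$. Let $\ell^2(\mathbb{N})^{\circ n}$ be the space of symmetric functions in $\ell^2(\mathbb{N}^n)$, and $\Delta_n=\{(k_1,\ldots,k_n)\in\mathbb{N}^n: k_i\ne k_j,\ 1\le i<j\le n\}$. For $f_n\in\ell^2(\mathbb{N})^{\circ n}$, $n\ge1$, the multiple stochastic integral is $J_n(f_n)=\sum_{(i_1,\ldots,i_n)\in\Delta_n}f_n(i_1,\ldots,i_n)Y_{i_1}\cdots Y_{i_n}$ (convergence in $L^2(\Omega)$), and $J_0(f_0)=f_0$ for $f_0\in\mathbb{R}$. Let $\mathcal{H}_0=\mathbb{R}$ and $\mathcal{H}_n=\{J_n(f_n):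 f_n\in\ell^2(\mathbb{N})^{\circ n}\}$ for $n\ge1$. *)

theory Defs
  imports
    "HOL-Probability.Probability"
    "HOL-Combinatorics.Permutations"
    "HOL-Library.Function_Algebras"
begin

text \<open>
  Elements of the real space \<open>L\<^sup>2(M)\<close> are represented by measurable functions. The space is not
  quotiented by almost-everywhere equality: orthogonality, convergence and closure are defined
  through the integral and hence do not depend on the choice of representatives.
\<close>

definition L2_space :: "'a measure \<Rightarrow> ('a \<Rightarrow> real) set" where
  "L2_space M = {F \<in> borel_measurable M. integrable M (\<lambda>x. (F x)\<^sup>2)}"

definition L2_inner :: "'a measure \<Rightarrow> ('a \<Rightarrow> real) \<Rightarrow> ('a \<Rightarrow> real) \<Rightarrow> real" where
  "L2_inner M F G = (LINT x|M. F x * G x)"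

definition L2_norm :: "'a measure \<Rightarrow> ('a \<Rightarrow> real) \<Rightarrow> real" where
  "L2_norm M F = sqrt (L2_inner M F F)"

definition L2_closure :: "'a measure \<Rightarrow> ('a \<Rightarrow> real) set \<Rightarrow> ('a \<Rightarrow> real) set" where
  "L2_closure M S = {F \<in> L2_space M. \<forall>\<epsilon>>0. \<exists>G\<in>S. L2_norm M (\<lambda>x. F x - G x) < \<epsilon>}"

text \<open>
  Unordered convergence in \<open>L\<^sup>2(M)\<close> of \<open>\<Sum>i\<in>A. u i\<close> to \<open>F\<close>, the analogue of \<open>has_sum\<close> for the
  \<open>L\<^sup>2\<close> seminorm; the limit \<open>F\<close> is determined up to almost-everywhere equality.
\<close>

definition has_L2_sum :: "'a measure \<Rightarrow> ('i \<Rightarrow> 'a \<Rightarrow> real) \<Rightarrow> 'i set \<Rightarrow> ('a \<Rightarrow> real) \<Rightarrow> bool" where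
  "has_L2_sum M u A F \<longleftrightarrow> F \<in> L2_space M \<and>
     ((\<lambda>I. L2_norm M (\<lambda>x. F x - (\<Sum>i\<in>I. u i x))) \<longlongrightarrow> 0) (finite_subsets_at_top A)"

global_interpretation real_fun: vector_space "\<lambda>(c::real) (F::'a \<Rightarrow> real) x. c * F x"
  defines real_fun_span = real_fun.span
  by unfold_locales (auto simp: fun_eq_iff algebra_simps)

text \<open>
  The points of the space of this measure are the sequences \<open>\<omega>\<close> with values in \<open>{-1, 1}\<close>, and the
  canonical projection \<open>X\<^sub>k\<close> is \<open>\<lambda>\<omega>. \<omega> k\<close>.
\<close>

definition bernoulli_space :: "(nat \<Rightarrow> real) \<Rightarrow> (nat \<Rightarrow> real) measure" where
  "bernoulli_space p =
     (\<Pi>\<^sub>M k\<in>UNIV. point_measure {-1, 1} (\<lambda>x. ennreal (if x = 1 then p k else 1 - p k)))"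

definition Y :: "(nat \<Rightarrow> real) \<Rightarrow> nat \<Rightarrow> (nat \<Rightarrow> real) \<Rightarrow> real" where
  "Y p k \<omega> = ((1 - p k) - p k + \<omega> k) / (2 * sqrt (p k * (1 - p k)))"

text \<open>
  An \<open>n\<close>-tuple of natural numbers is a list of length \<open>n\<close>. A function on \<open>\<nat>\<^sup>n\<close> is given by
  a function on all lists whose values on lists of other lengths are irrelevant.
\<close>

definition sym_l2 :: "nat \<Rightarrow> (nat list \<Rightarrow> real) set" where
  "sym_l2 n = {f. (\<lambda>ks. (f ks)\<^sup>2) summable_on {ks. length ks = n} \<and>
     (\<forall>ks \<pi>. length ks = n \<longrightarrow> \<pi> permutes {..<n} \<longrightarrow> f (permute_list \<pi> ks) = f ks)}"

definition \<Delta> :: "nat \<Rightarrow> nat list set" where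
  "\<Delta> n = {ks. length ks = n \<and> (\<forall>i j. i < j \<and> j < n \<longrightarrow> ks ! i \<noteq> ks ! j)}"

text \<open>\<open>is_J p n f F\<close> says that \<open>F\<close> is a representative of \<open>J\<^sub>n(f)\<close>, for \<open>n \<ge> 1\<close>.\<close>

definition is_J :: "(nat \<Rightarrow> real) \<Rightarrow> nat \<Rightarrow> (nat list \<Rightarrow> real) \<Rightarrow> ((nat \<Rightarrow> real) \<Rightarrow> real) \<Rightarrow> bool" where
  "is_J p n f F \<longleftrightarrow>
     has_L2_sum (bernoulli_space p) (\<lambda>ks \<omega>. f ks * (\<Prod>i<n. Y p (ks ! i) \<omega>)) (\<Delta> n) F"

definition chaos :: "(nat \<Rightarrow> real) \<Rightarrow> nat \<Rightarrow> ((nat \<Rightarrow> real) \<Rightarrow> real) set" where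
  "chaos p n =
     (if n = 0 then {F \<in> L2_space (bernoulli_space p). \<exists>c. AE \<omega> in bernoulli_space p. F \<omega> = c}
      else {F. \<exists>f\<in>sym_l2 n. is_J p n f F})"

end

theory Submission
  imports Defs
begin

text \<open>
  Write \<open>Y\<^sub>A\<close> for the product of the \<open>Y\<^sub>k\<close> with \<open>k \<in> A\<close>, \<open>A\<close> finite. By independence and
  \<open>E[Y\<^sub>k] = 0\<close> one has \<open>E[Y\<^sub>A Y\<^sub>B] = 0\<close> for \<open>A \<noteq> B\<close>. Elements of the \<open>n\<close>-th chaos are \<open>L\<^sup>2\<close> limits of
  linear combinations of the \<open>Y\<^sub>A\<close> with \<open>card A = n\<close>, so continuity of the inner product gives
  orthogonality of different chaoses.

  For density, a function of one coordinate \<open>\<omega>\<^sub>k \<in> {-1, 1}\<close> is affine in \<open>Y\<^sub>k\<close>. Hence the indicator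
  of a cylinder, being a finite product of such functions, is a linear combination of the \<open>Y\<^sub>A\<close>.
  The cylinders are an intersection-stable generator, so Dynkin's lemma puts the indicators of all
  measurable sets into the closure of the span, and simple functions are dense in \<open>L\<^sup>2\<close>.
\<close>

section \<open>The space of square integrable functions\<close>

lemma L2_space_iff:
  "F \<in> L2_space M \<longleftrightarrow> F \<in> borel_measurable M \<and> integrable M (\<lambda>x. (F x)\<^sup>2)"
  by (simp add: L2_space_def)

lemma L2_space_integrable_mult:
  assumes "F \<in> L2_space M" "G \<in> L2_space M"
  shows "integrable M (\<lambda>x. F x * G x)"
proof (rule Bochner_Integration.integrable_bound)
  show "integrable M (\<lambda>x. (F x)\<^sup>2 + (G x)\<^sup>2)"
    using assms by (simp add: L2_space_iff)
  show "(\<lambda>x. F x * G x) \<in> borel_measurable M"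
    using assms by (auto simp: L2_space_iff)
  have "\<bar>a * b\<bar> \<le> a\<^sup>2 + b\<^sup>2" for a b :: real
  proof -
    have "2 * \<bar>a * b\<bar> \<le> a\<^sup>2 + b\<^sup>2"
      using sum_squares_bound[of "\<bar>a\<bar>" "\<bar>b\<bar>"] by (simp add: abs_mult)
    then show ?thesis
      by linarith
  qed
  then show "AE x in M. norm (F x * G x) \<le> norm ((F x)\<^sup>2 + (G x)\<^sup>2)"
    by (intro always_eventually allI) simp
qed

lemma L2_space_dominated:
  assumes "F \<in> borel_measurable M" "G \<in> L2_space M" "\<And>x. x \<in> space M \<Longrightarrow> \<bar>F x\<bar> \<le> G x"
  shows "F \<in> L2_space M"
proof -
  have "integrable M (\<lambda>x. (F x)\<^sup>2)"
  proof (rule Bochner_Integration.integrable_bound)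
    show "integrable M (\<lambda>x. (G x)\<^sup>2)" "(\<lambda>x. (F x)\<^sup>2) \<in> borel_measurable M"
      using assms by (simp_all add: L2_space_iff)
    show "AE x in M. norm ((F x)\<^sup>2) \<le> norm ((G x)\<^sup>2)"
      using assms(3) by (intro AE_I2) (fastforce simp flip: abs_le_square_iff)
  qed
  then show ?thesis
    using assms(1) by (simp add: L2_space_iff)
qed

lemma L2_space_scale: "F \<in> L2_space M \<Longrightarrow> (\<lambda>x. c * F x) \<in> L2_space M"
  by (auto simp: L2_space_iff power_mult_distrib)

lemma L2_space_add:
  assumes "F \<in> L2_space M" "G \<in> L2_space M"
  shows "(\<lambda>x. F x + G x) \<in> L2_space M"
  using assms L2_space_integrable_mult[OF assms]
  by (auto simp: L2_space_iff power2_sum mult.assoc)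

lemma L2_space_diff:
  assumes "F \<in> L2_space M" "G \<in> L2_space M"
  shows "(\<lambda>x. F x - G x) \<in> L2_space M"
  using L2_space_add[OF assms(1) L2_space_scale[OF assms(2), of "-1"]] by simp

lemma L2_space_zero: "(\<lambda>x. 0) \<in> L2_space M"
  by (simp add: L2_space_iff)

lemma L2_space_sum:
  assumes "\<And>i. i \<in> I \<Longrightarrow> u i \<in> L2_space M"
  shows "(\<lambda>x. \<Sum>i\<in>I. u i x) \<in> L2_space M"
  using assms
  by (induction I rule: infinite_finite_induct) (auto intro: L2_space_zero L2_space_add)

lemma (in finite_measure) L2_space_bounded:
  assumes "F \<in> borel_measurable M" "\<And>x. x \<in> space M \<Longrightarrow> \<bar>F x\<bar> \<le> B"
  shows "F \<in> L2_space M"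
  by (rule L2_space_dominated[OF assms(1) _ assms(2)]) (auto simp: L2_space_iff)

section \<open>Inner product and seminorm\<close>

lemma L2_inner_commute: "L2_inner M F G = L2_inner M G F"
  by (simp add: L2_inner_def mult.commute)

lemma L2_inner_self_nonneg: "0 \<le> L2_inner M F F"
  by (simp add: L2_inner_def)

lemma L2_norm_nonneg: "0 \<le> L2_norm M F"
  by (simp add: L2_norm_def L2_inner_self_nonneg)

lemma L2_norm_square: "(L2_norm M F)\<^sup>2 = L2_inner M F F"
  by (simp add: L2_norm_def L2_inner_self_nonneg)

lemma L2_norm_zero: "L2_norm M (\<lambda>x. 0) = 0"
  by (simp add: L2_norm_def L2_inner_def)

lemma L2_norm_scale: "L2_norm M (\<lambda>x. c * F x) = \<bar>c\<bar> * L2_norm M F"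
proof -
  have square: "c * F x * (c * F x) = c\<^sup>2 * (F x * F x)" for x
    by (simp add: power2_eq_square)
  have "L2_inner M (\<lambda>x. c * F x) (\<lambda>x. c * F x) = c\<^sup>2 * L2_inner M F F"
    by (simp only: L2_inner_def square integral_mult_right_zero)
  then show ?thesis
    by (simp add: L2_norm_def real_sqrt_mult)
qed

text \<open>This is the inequality for nonnegative extended integrals applied to |F| and |G|. Square
  integrability makes all three integrals finite, so the result transfers to the reals.\<close>

lemma L2_Cauchy_Schwarz:
  assumes "F \<in> L2_space M" "G \<in> L2_space M"
  shows "\<bar>L2_inner M F G\<bar> \<le> L2_norm M F * L2_norm M G"
proof -
  have int: "integrable M (\<lambda>x. F x * G x)" "integrable M (\<lambda>x. (F x)\<^sup>2)" "integrable M (\<lambda>x. (G x)\<^sup>2)"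
    and meas: "F \<in> borel_measurable M" "G \<in> borel_measurable M"
    using assms L2_space_integrable_mult[OF assms] by (auto simp: L2_space_iff)
  have nn: "(\<integral>\<^sup>+x. (ennreal \<bar>H x\<bar>)\<^sup>2 \<partial>M) = ennreal (L2_inner M H H)"
    if "integrable M (\<lambda>x. (H x)\<^sup>2)" for H
    using nn_integral_eq_integral[OF that]
    by (simp add: L2_inner_def ennreal_power flip: power2_eq_square)
  have "ennreal ((LINT x|M. \<bar>F x * G x\<bar>)\<^sup>2) = (\<integral>\<^sup>+x. ennreal \<bar>F x\<bar> * ennreal \<bar>G x\<bar> \<partial>M)\<^sup>2"
    using nn_integral_eq_integral[OF integrable_abs[OF int(1)]]
    by (simp add: ennreal_power abs_mult ennreal_mult)
  also have "\<dots> \<le> (\<integral>\<^sup>+x. (ennreal \<bar>F x\<bar>)\<^sup>2 \<partial>M) * (\<integral>\<^sup>+x. (ennreal \<bar>G x\<bar>)\<^sup>2 \<partial>M)"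
    using meas by (intro Cauchy_Schwarz_nn_integral) auto
  also have "\<dots> = ennreal ((L2_norm M F * L2_norm M G)\<^sup>2)"
    by (simp add: nn int L2_norm_square power_mult_distrib ennreal_mult L2_inner_self_nonneg)
  finally have "(LINT x|M. \<bar>F x * G x\<bar>)\<^sup>2 \<le> (L2_norm M F * L2_norm M G)\<^sup>2"
    by (simp add: ennreal_le_iff)
  then have "(LINT x|M. \<bar>F x * G x\<bar>) \<le> L2_norm M F * L2_norm M G"
    by (rule power2_le_imp_le) (simp add: L2_norm_nonneg)
  then show ?thesis
    unfolding L2_inner_def using integral_abs_bound[of M "\<lambda>x. F x * G x"] by linarith
qed

lemma L2_norm_triangle:
  assumes "F \<in> L2_space M" "G \<in> L2_space M"
  shows "L2_norm M (\<lambda>x. F x + G x) \<le> L2_norm M F + L2_norm M G"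
proof (rule power2_le_imp_le)
  have "L2_inner M (\<lambda>x. F x + G x) (\<lambda>x. F x + G x) =
      L2_inner M F F + 2 * L2_inner M F G + L2_inner M G G"
    unfolding L2_inner_def using assms
    by (simp add: ring_distribs L2_space_integrable_mult mult.commute)
  then show "(L2_norm M (\<lambda>x. F x + G x))\<^sup>2 \<le> (L2_norm M F + L2_norm M G)\<^sup>2"
    using L2_Cauchy_Schwarz[OF assms] by (simp add: L2_norm_square power2_sum)
qed (simp add: L2_norm_nonneg)

text \<open>Each partial sum is orthogonal to \<open>H\<close>, so subtracting it from
  \<open>F\<close> leaves the inner product unchanged. Cauchy-Schwarz then bounds that fixed number
  by a quantity tending to 0.\<close>

lemma has_L2_sum_orthogonal:
  assumes sum: "has_L2_sum M u A F" and H: "H \<in> L2_space M"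
    and u: "\<And>i. i \<in> A \<Longrightarrow> u i \<in> L2_space M"
    and orth: "\<And>i. i \<in> A \<Longrightarrow> L2_inner M (u i) H = 0"
  shows "L2_inner M F H = 0"
proof -
  define r where "r I = L2_norm M (\<lambda>x. F x - (\<Sum>i\<in>I. u i x))" for I
  have F: "F \<in> L2_space M" and lim: "(r \<longlongrightarrow> 0) (finite_subsets_at_top A)"
    using sum by (simp_all add: has_L2_sum_def r_def[abs_def])
  have "\<bar>L2_inner M F H\<bar> \<le> r I * L2_norm M H" if I: "I \<subseteq> A" for I
  proof -
    have uI: "(\<lambda>x. \<Sum>i\<in>I. u i x) \<in> L2_space M"
      using u I by (intro L2_space_sum) auto
    have "(LINT x|M. (\<Sum>i\<in>I. u i x) * H x) = (\<Sum>i\<in>I. L2_inner M (u i) H)"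
      unfolding sum_distrib_right L2_inner_def
      using u H I by (intro Bochner_Integration.integral_sum L2_space_integrable_mult) auto
    also have "\<dots> = 0"
      using orth I by (intro sum.neutral) auto
    finally have "L2_inner M F H = L2_inner M (\<lambda>x. F x - (\<Sum>i\<in>I. u i x)) H"
      by (simp add: L2_inner_def left_diff_distrib L2_space_integrable_mult[OF F H]
          L2_space_integrable_mult[OF uI H])
    then show ?thesis
      using L2_Cauchy_Schwarz[OF L2_space_diff[OF F uI] H] by (simp add: r_def)
  qed
  then have "\<forall>\<^sub>F I in finite_subsets_at_top A. \<bar>L2_inner M F H\<bar> \<le> r I * L2_norm M H"
    by (auto intro: eventually_finite_subsets_at_top_weakI)
  moreover have "((\<lambda>I. r I * L2_norm M H) \<longlongrightarrow> 0) (finite_subsets_at_top A)"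
    using tendsto_mult[OF lim tendsto_const] by simp
  ultimately have "\<bar>L2_inner M F H\<bar> \<le> 0"
    by (intro tendsto_lowerbound[of _ 0 "finite_subsets_at_top A"]) auto
  then show ?thesis
    by simp
qed

section \<open>Closures of subspaces\<close>

lemma subspace_L2_space: "real_fun.subspace (L2_space M)"
  unfolding real_fun.subspace_def zero_fun_def plus_fun_def
  by (blast intro: L2_space_zero L2_space_add L2_space_scale)

lemma L2_closureI:
  assumes "F \<in> L2_space M" "\<And>\<epsilon>. \<epsilon> > 0 \<Longrightarrow> \<exists>G\<in>S. L2_norm M (\<lambda>x. F x - G x) < \<epsilon>"
  shows "F \<in> L2_closure M S"
  using assms by (simp add: L2_closure_def)

lemma L2_closureE:
  assumes "F \<in> L2_closure M S" "\<epsilon> > 0"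
  obtains G where "G \<in> S" "L2_norm M (\<lambda>x. F x - G x) < \<epsilon>"
  using assms by (auto simp: L2_closure_def)

lemma L2_closure_subset: "L2_closure M S \<subseteq> L2_space M"
  by (auto simp: L2_closure_def)

lemma L2_closure_incl: "S \<subseteq> L2_space M \<Longrightarrow> S \<subseteq> L2_closure M S"
  by (intro subsetI L2_closureI bexI) (auto simp: L2_norm_zero)

context
  fixes M :: "'a measure" and S :: "('a \<Rightarrow> real) set"
  assumes sub: "real_fun.subspace S" and S: "S \<subseteq> L2_space M"
begin

lemma L2_closure_add:
  assumes "F \<in> L2_closure M S" "G \<in> L2_closure M S"
  shows "(\<lambda>x. F x + G x) \<in> L2_closure M S"
proof (rule L2_closureI)
  have FG: "F \<in> L2_space M" "G \<in> L2_space M"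
    using assms L2_closure_subset by auto
  then show "(\<lambda>x. F x + G x) \<in> L2_space M"
    by (rule L2_space_add)
  fix \<epsilon> :: real assume "\<epsilon> > 0"
  then have e: "\<epsilon> / 2 > 0" by simp
  obtain F' where F': "F' \<in> S" "L2_norm M (\<lambda>x. F x - F' x) < \<epsilon> / 2"
    using L2_closureE[OF assms(1) e] .
  obtain G' where G': "G' \<in> S" "L2_norm M (\<lambda>x. G x - G' x) < \<epsilon> / 2"
    using L2_closureE[OF assms(2) e] .
  have "F' + G' \<in> S"
    using real_fun.subspace_add[OF sub F'(1) G'(1)] .
  moreover have "L2_norm M (\<lambda>x. (F x + G x) - (F' + G') x) \<le>
      L2_norm M (\<lambda>x. F x - F' x) + L2_norm M (\<lambda>x. G x - G' x)"
    using L2_norm_triangle[of "\<lambda>x. F x - F' x" M "\<lambda>x. G x - G' x"] FG F' G' S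
    by (simp add: L2_space_diff subset_iff add_diff_add)
  ultimately show "\<exists>H\<in>S. L2_norm M (\<lambda>x. (F x + G x) - H x) < \<epsilon>"
    using F'(2) G'(2) by (intro bexI[of _ "F' + G'"]) auto
qed

lemma L2_closure_scale:
  assumes "F \<in> L2_closure M S"
  shows "(\<lambda>x. c * F x) \<in> L2_closure M S"
proof (rule L2_closureI)
  show "(\<lambda>x. c * F x) \<in> L2_space M"
    using assms L2_closure_subset by (auto intro: L2_space_scale)
  fix \<epsilon> :: real assume e: "\<epsilon> > 0"
  \<comment> \<open>The summand 1 keeps the divisor positive when \<open>c = 0\<close>.\<close>
  then have "\<epsilon> / (\<bar>c\<bar> + 1) > 0"
    by (simp add: add_nonneg_pos)
  then obtain G where G: "G \<in> S" "L2_norm M (\<lambda>x. F x - G x) < \<epsilon> / (\<bar>c\<bar> + 1)"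
    using L2_closureE[OF assms] by blast
  have "L2_norm M (\<lambda>x. c * F x - c * G x) = \<bar>c\<bar> * L2_norm M (\<lambda>x. F x - G x)"
    using L2_norm_scale[of M c "\<lambda>x. F x - G x"] by (simp add: right_diff_distrib)
  also have "\<dots> \<le> (\<bar>c\<bar> + 1) * L2_norm M (\<lambda>x. F x - G x)"
    by (intro mult_right_mono L2_norm_nonneg) simp
  also have "\<dots> < \<epsilon>"
    using G(2) by (simp add: field_simps)
  finally show "\<exists>H\<in>S. L2_norm M (\<lambda>x. c * F x - H x) < \<epsilon>"
    using real_fun.subspace_scale[OF sub G(1)] by (intro bexI[of _ "\<lambda>x. c * G x"])
qed

lemma L2_closure_sum:
  assumes "\<And>i. i \<in> I \<Longrightarrow> F i \<in> L2_closure M S"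
  shows "(\<lambda>x. \<Sum>i\<in>I. F i x) \<in> L2_closure M S"
proof -
  \<comment> \<open>The zero function serves the empty sum and also infinite \<open>I\<close>, where
    the sum is 0 by convention.\<close>
  have "(\<lambda>x. 0) \<in> L2_closure M S"
    using L2_closure_incl[OF S] real_fun.subspace_0[OF sub] by (auto simp: zero_fun_def)
  then show ?thesis
    using assms by (induction I rule: infinite_finite_induct) (auto intro: L2_closure_add)
qed

section \<open>Dominated limits and density criteria\<close>

text \<open>Dominated convergence turns the pointwise limit into an L2 limit. An approximant
  \<open>F i\<close> of \<open>G\<close> is itself approximated from \<open>S\<close>, each time up
  to half of the error.\<close>

lemma L2_closure_dominated_limit:
  assumes F: "\<And>i. F i \<in> L2_closure M S" and D: "D \<in> L2_space M"
    and bound: "\<And>i x. x \<in> space M \<Longrightarrow> \<bar>F i x\<bar> \<le> D x"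
    and lim: "\<And>x. x \<in> space M \<Longrightarrow> (\<lambda>i. F i x) \<longlonglongrightarrow> G x"
  shows "G \<in> L2_closure M S"
proof (rule L2_closureI)
  have FL: "F i \<in> L2_space M" for i
    using F L2_closure_subset by auto
  have "G \<in> borel_measurable M"
    using FL lim by (intro borel_measurable_LIMSEQ_real[of M F G]) (auto simp: L2_space_iff)
  moreover have GD: "\<bar>G x\<bar> \<le> D x" if "x \<in> space M" for x
    using tendsto_upperbound[OF tendsto_rabs[OF lim[OF that]], of "D x"] bound[OF that] by simp
  ultimately show GL: "G \<in> L2_space M"
    using D by (auto intro: L2_space_dominated)
  have "(\<lambda>i. LINT x|M. (G x - F i x) * (G x - F i x)) \<longlonglongrightarrow> (LINT x|M. 0)"
  proof (rule integral_dominated_convergence)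
    \<comment> \<open>Both \<open>G\<close> and \<open>F i\<close> are bounded by \<open>D\<close>,
      so their difference is bounded by \<open>2 * D x\<close>, whose square is this dominating
      function.\<close>
    show "integrable M (\<lambda>x. 4 * (D x)\<^sup>2)"
      using D by (simp add: L2_space_iff)
    show "AE x in M. (\<lambda>i. (G x - F i x) * (G x - F i x)) \<longlonglongrightarrow> 0"
    proof (rule AE_I2)
      fix x assume "x \<in> space M"
      then have "(\<lambda>i. G x - F i x) \<longlonglongrightarrow> G x - G x"
        by (intro tendsto_intros lim)
      then show "(\<lambda>i. (G x - F i x) * (G x - F i x)) \<longlonglongrightarrow> 0"
        using tendsto_mult by fastforce
    qed
    show "AE x in M. norm ((G x - F i x) * (G x - F i x)) \<le> 4 * (D x)\<^sup>2" for i
    proof (rule AE_I2)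
      fix x assume "x \<in> space M"
      then have "\<bar>G x - F i x\<bar> \<le> \<bar>2 * D x\<bar>"
        using bound[of x i] GD[of x] by linarith
      then show "norm ((G x - F i x) * (G x - F i x)) \<le> 4 * (D x)\<^sup>2"
        by (subst (asm) abs_le_square_iff) (simp add: power2_eq_square)
    qed
    show "(\<lambda>x. (G x - F i x) * (G x - F i x)) \<in> borel_measurable M" for i
      using GL FL[of i] by (auto simp: L2_space_iff)
  qed simp
  then have "(\<lambda>i. L2_norm M (\<lambda>x. G x - F i x)) \<longlonglongrightarrow> 0"
    unfolding L2_norm_def L2_inner_def using tendsto_real_sqrt by fastforce
  then have "\<exists>i. L2_norm M (\<lambda>x. G x - F i x) < \<epsilon> / 2" if "\<epsilon> > 0" for \<epsilon>
    using that order_tendstoD(2)[of _ 0 sequentially "\<epsilon> / 2"] eventually_happens by fastforce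
  moreover
  fix \<epsilon> :: real assume e: "\<epsilon> > 0"
  ultimately obtain i where i: "L2_norm M (\<lambda>x. G x - F i x) < \<epsilon> / 2"
    by blast
  from e obtain H where H: "H \<in> S" "L2_norm M (\<lambda>x. F i x - H x) < \<epsilon> / 2"
    using L2_closureE[OF F[of i], of "\<epsilon> / 2"] by auto
  have "L2_norm M (\<lambda>x. G x - H x) \<le> L2_norm M (\<lambda>x. G x - F i x) + L2_norm M (\<lambda>x. F i x - H x)"
    using L2_norm_triangle[of "\<lambda>x. G x - F i x" M "\<lambda>x. F i x - H x"] GL FL[of i] H S
    by (simp add: L2_space_diff subset_iff)
  with i H show "\<exists>H\<in>S. L2_norm M (\<lambda>x. G x - H x) < \<epsilon>"
    by (intro bexI[of _ H]) auto
qed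

text \<open>The constant sequence \<open>F\<close> converges to \<open>G\<close> on
  \<open>space M\<close> and is dominated by |F|. This allows replacing a function by one that
  agrees with it only on the space.\<close>

lemma L2_closure_cong:
  assumes "F \<in> L2_closure M S" "\<And>x. x \<in> space M \<Longrightarrow> G x = F x"
  shows "G \<in> L2_closure M S"
proof (rule L2_closure_dominated_limit)
  have "F \<in> L2_space M"
    using assms(1) L2_closure_subset by auto
  then show "(\<lambda>x. \<bar>F x\<bar>) \<in> L2_space M"
    by (auto simp: L2_space_iff)
qed (use assms in auto)

text \<open>Simple functions are finite combinations of indicators, and every \<open>F\<close> is a
  pointwise limit of simple functions dominated by 2|F|.\<close>

lemma L2_space_subset_closure_if_indicators:
  assumes ind: "\<And>A. A \<in> sets M \<Longrightarrow> indicator A \<in> L2_closure M S"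
  shows "L2_space M \<subseteq> L2_closure M S"
proof
  fix F assume F: "F \<in> L2_space M"
  then have "F \<in> borel_measurable M"
    by (simp add: L2_space_iff)
  \<comment> \<open>With base point 0 the distances in the bound are absolute values, which yields
    the dominating function 2|F|.\<close>
  from borel_measurable_implies_sequence_metric[OF this, of 0] obtain s where
    s: "\<And>i. simple_function M (s i)"
    and lim: "\<And>x. x \<in> space M \<Longrightarrow> (\<lambda>i. s i x) \<longlonglongrightarrow> F x"
    and bound: "\<And>i x. x \<in> space M \<Longrightarrow> dist (s i x) 0 \<le> 2 * dist (F x) 0"
    by blast
  show "F \<in> L2_closure M S"
  proof (rule L2_closure_dominated_limit[OF _ _ _ lim])
    fix i
    have "(\<lambda>x. \<Sum>y\<in>s i ` space M. y * indicator (s i -` {y} \<inter> space M) x) \<in> L2_closure M S"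
      using s by (intro L2_closure_sum L2_closure_scale ind) (auto intro: simple_functionD)
    then show "s i \<in> L2_closure M S"
    proof (rule L2_closure_cong)
      fix x assume x: "x \<in> space M"
      have "(\<Sum>y\<in>s i ` space M. y * indicator (s i -` {y} \<inter> space M) x) =
          (\<Sum>y\<in>s i ` space M. if y = s i x then s i x else 0)"
        using x by (intro sum.cong) (auto simp: indicator_def)
      also have "\<dots> = s i x"
        using x simple_functionD(1)[OF s] by (simp add: sum.delta')
      finally show "s i x = (\<Sum>y\<in>s i ` space M. y * indicator (s i -` {y} \<inter> space M) x)"
        by simp
    qed
  next
    show "(\<lambda>x. 2 * \<bar>F x\<bar>) \<in> L2_space M"
      using F by (intro L2_space_scale) (auto simp: L2_space_iff)
  qed (use bound in auto)
qed

text \<open>Sets whose indicator lies in the closure form a Dynkin system: complements come from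
  subtracting from the constant 1, and countable disjoint unions from limits dominated by 1, which
  is square integrable as \<open>M\<close> is finite.\<close>

lemma L2_space_subset_closure_if_generator:
  assumes fin: "finite_measure M" and gen: "sets M = sigma_sets (space M) \<G>"
    and stable: "Int_stable \<G>" and one: "(\<lambda>x. 1) \<in> L2_closure M S"
    and ind: "\<And>A. A \<in> \<G> \<Longrightarrow> indicator A \<in> L2_closure M S"
  shows "L2_space M \<subseteq> L2_closure M S"
proof (rule L2_space_subset_closure_if_indicators)
  interpret finite_measure M by fact
  have \<G>: "\<G> \<subseteq> Pow (space M)"
    using gen sets.sets_into_space by blast
  fix A assume "A \<in> sets M"
  then have "A \<in> sigma_sets (space M) \<G>"
    by (simp add: gen)
  from stable \<G> this show "(indicator A :: 'a \<Rightarrow> real) \<in> L2_closure M S"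
  proof (induction rule: sigma_sets_induct_disjoint)
    case (basic A)
    then show ?case by (rule ind)
  next
    case empty
    have "(\<lambda>x. 0 * 1) \<in> L2_closure M S"
      by (rule L2_closure_scale[OF one])
    then show ?case
      by (simp add: indicator_def)
  next
    case (compl A)
    have "(\<lambda>x. 1 + (-1) * indicator A x) \<in> L2_closure M S"
      by (intro L2_closure_add L2_closure_scale one compl)
    then show ?case
      by (rule L2_closure_cong) (auto simp: indicator_def)
  next
    case (union A)
    show ?case
    proof (rule L2_closure_dominated_limit)
      show "(\<lambda>x. \<Sum>i<n. indicator (A i) x) \<in> L2_closure M S" for n
        by (intro L2_closure_sum union)
      show "(\<lambda>x. 1) \<in> L2_space M"
        by (rule L2_space_bounded[of _ 1]) auto
      fix x
      have sums: "(\<lambda>i. indicator (A i) x) sums (indicator (\<Union>i. A i) x :: real)"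
        using union(1) by (intro indicator_sums) (auto simp: disjoint_family_on_def)
      then show "(\<lambda>n. \<Sum>i<n. indicator (A i) x) \<longlonglongrightarrow> (indicator (\<Union>i. A i) x :: real)"
        by (simp add: sums_def)
      show "\<bar>\<Sum>i<n. indicator (A i) x :: real\<bar> \<le> 1" for n
      proof -
        \<comment> \<open>By disjointness the full series is the indicator of the union, hence at
          most 1, and its terms are nonnegative.\<close>
        have "(\<Sum>i<n. indicator (A i) x :: real) \<le> (\<Sum>i. indicator (A i) x)"
          by (intro sum_le_suminf) (use sums sums_summable in auto)
        also have "\<dots> \<le> 1"
          using sums_unique[OF sums] by (metis indicator_le_1)
        finally show ?thesis
          by (simp add: sum_nonneg del: sum_indicator_eq_card sum_of_bool_eq)
      qed
    qed
  qed
qed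

end

section \<open>The Bernoulli space\<close>

abbreviation bernoulli_factor :: "(nat \<Rightarrow> real) \<Rightarrow> nat \<Rightarrow> real measure" where
  "bernoulli_factor p k \<equiv>
     point_measure {-1, 1} (\<lambda>x. ennreal (if x = 1 then p k else 1 - p k))"

text \<open>This is \<open>Y\<^sub>A\<close>. For infinite \<open>A\<close> it is the constant 1 by
  the convention for products, so measurability and square integrability hold for every
  \<open>A\<close>.\<close>

definition Y_prod :: "(nat \<Rightarrow> real) \<Rightarrow> nat set \<Rightarrow> (nat \<Rightarrow> real) \<Rightarrow> real" where
  "Y_prod p A \<omega> = (\<Prod>k\<in>A. Y p k \<omega>)"

lemma space_bernoulli_space: "space (bernoulli_space p) = UNIV \<rightarrow> {-1, 1}"
  by (simp add: bernoulli_space_def space_PiM space_point_measure PiE_def)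

text \<open>A point measure carries the power set as its sigma-algebra.\<close>

lemma bernoulli_factor_measurable: "f \<in> borel_measurable (bernoulli_factor p k)"
  by (simp add: point_measure_def)

lemma bernoulli_space_projection_measurable:
  "(\<lambda>\<omega>. \<omega> k) \<in> bernoulli_space p \<rightarrow>\<^sub>M bernoulli_factor p k"
  unfolding bernoulli_space_def by (rule measurable_component_singleton) simp

lemma bernoulli_space_component_measurable:
  "(\<lambda>\<omega>. f (\<omega> k)) \<in> borel_measurable (bernoulli_space p)" for f :: "real \<Rightarrow> real"
  by (rule measurable_compose[where g = f, OF bernoulli_space_projection_measurable
      bernoulli_factor_measurable])

lemma Y_eq: "Y p k \<omega> = (1 - 2 * p k + \<omega> k) / (2 * sqrt (p k * (1 - p k)))"
  by (simp add: Y_def)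

lemma Y_measurable: "Y p k \<in> borel_measurable (bernoulli_space p)"
  unfolding Y_eq[abs_def]
  by (rule bernoulli_space_component_measurable
      [of "\<lambda>x. (1 - 2 * p k + x) / (2 * sqrt (p k * (1 - p k)))"])

lemma Y_prod_measurable: "Y_prod p A \<in> borel_measurable (bernoulli_space p)"
  unfolding Y_prod_def[abs_def] by (intro borel_measurable_prod Y_measurable)

section \<open>Tuples with distinct entries\<close>

lemma \<Delta>_eq: "\<Delta> n = {ks. length ks = n \<and> distinct ks}"
proof -
  have "(\<forall>i j. i < j \<and> j < length ks \<longrightarrow> ks ! i \<noteq> ks ! j) \<longleftrightarrow> distinct ks" for ks :: "nat list"
  proof
    assume nth: "\<forall>i j. i < j \<and> j < length ks \<longrightarrow> ks ! i \<noteq> ks ! j"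
    show "distinct ks"
      unfolding distinct_conv_nth
    proof (intro allI impI)
      fix i j assume "i < length ks" "j < length ks" "i \<noteq> j"
      then show "ks ! i \<noteq> ks ! j"
        using nth[rule_format, of i j] nth[rule_format, of j i] by (cases i j rule: linorder_cases) auto
    qed
  qed (simp add: nth_eq_iff_index_eq)
  then show ?thesis
    unfolding \<Delta>_def by blast
qed

text \<open>Distinctness makes positions and entries correspond bijectively. So the product depends
  only on the set of entries, and reorderings of a tuple share one product.\<close>

lemma prod_Y_eq_Y_prod:
  assumes "ks \<in> \<Delta> n"
  shows "(\<Prod>i<n. Y p (ks ! i) \<omega>) = Y_prod p (set ks) \<omega>"
proof -
  have "bij_betw ((!) ks) {..<n} (set ks)"
    using assms by (auto simp: \<Delta>_eq intro: bij_betw_nth)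
  then show ?thesis
    unfolding Y_prod_def by (rule prod.reindex_bij_betw)
qed

lemma finite_lists_with_set: "finite {ks. length ks = n \<and> set ks = B}"
proof (cases "finite B")
  case True
  then show ?thesis
    by (intro finite_subset[OF _ finite_lists_length_eq[of B n]]) auto
next
  case False
  then have "{ks. length ks = n \<and> set ks = B} = {}"
    by auto
  then show ?thesis
    by (simp only: finite.emptyI)
qed

context
  fixes p :: "nat \<Rightarrow> real"
  assumes p: "\<And>k. 0 < p k \<and> p k < 1"
begin

section \<open>Independence and orthogonality of the products\<close>

lemma prob_space_bernoulli_factor: "prob_space (bernoulli_factor p k)"
proof (rule prob_spaceI)
  have "emeasure (bernoulli_factor p k) {-1, 1} = ennreal (1 - p k) + ennreal (p k)"
    by (subst emeasure_point_measure_finite) auto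
  also have "\<dots> = 1"
    using p[of k] by (simp flip: ennreal_plus)
  finally show "emeasure (bernoulli_factor p k) (space (bernoulli_factor p k)) = 1"
    by (simp add: space_point_measure)
qed

lemma prob_space_bernoulli_space: "prob_space (bernoulli_space p)"
  unfolding bernoulli_space_def by (intro prob_space_PiM prob_space_bernoulli_factor)

interpretation bernoulli: prob_space "bernoulli_space p"
  by (rule prob_space_bernoulli_space)

lemma expectation_Y: "(LINT \<omega>|bernoulli_space p. Y p k \<omega>) = 0"
proof -
  let ?g = "\<lambda>x. (1 - 2 * p k + x) / (2 * sqrt (p k * (1 - p k)))"
  have "(LINT x|bernoulli_factor p k. ?g x) =
      (LINT x|distr (bernoulli_space p) (bernoulli_factor p k) (\<lambda>\<omega>. \<omega> k). ?g x)"
    unfolding bernoulli_space_def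
    by (subst distr_PiM_component) (auto intro: prob_space_bernoulli_factor)
  also have "\<dots> = (LINT \<omega>|bernoulli_space p. Y p k \<omega>)"
    unfolding Y_eq
    by (rule integral_distr[OF bernoulli_space_projection_measurable bernoulli_factor_measurable])
  finally have "(LINT \<omega>|bernoulli_space p. Y p k \<omega>) = (LINT x|bernoulli_factor p k. ?g x)"
    by simp
  also have "\<dots> = (\<Sum>x\<in>{-1, 1}. (if x = 1 then p k else 1 - p k) *\<^sub>R ?g x)"
    using p[of k] by (intro lebesgue_integral_point_measure_finite) auto
  \<comment> \<open>The weighted numerators are \<open>p k * (2 - 2 * p k)\<close> and
    \<open>(1 - p k) * (- 2 * p k)\<close>, which cancel.\<close>
  also have "\<dots> = 0"
    using p[of k] by (simp add: field_simps)
  finally show ?thesis .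
qed

text \<open>The coordinates are independent because their joint law, the measure itself, is the
  product of their marginals. Arbitrary \<open>f k\<close> are admissible since the factors are
  discrete.\<close>

lemma indep_vars_components:
  "bernoulli.indep_vars (\<lambda>_. borel) (\<lambda>k \<omega>. f k (\<omega> k)) A" for f :: "nat \<Rightarrow> real \<Rightarrow> real"
proof -
  have eq: "bernoulli_space p = PiM UNIV (bernoulli_factor p)"
    by (simp add: bernoulli_space_def)
  \<comment> \<open>Restriction to \<open>UNIV\<close> is the identity, so the left side is the
    original measure; on the right each marginal is the corresponding factor.\<close>
  have "distr (bernoulli_space p) (PiM UNIV (bernoulli_factor p)) (\<lambda>\<omega>. \<lambda>k\<in>UNIV. \<omega> k) =
      (\<Pi>\<^sub>M k\<in>UNIV. distr (bernoulli_space p) (bernoulli_factor p k) (\<lambda>\<omega>. \<omega> k))"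
    unfolding eq
    by (subst distr_PiM_component) (auto simp: restrict_def distr_id2 prob_space_bernoulli_factor)
  then have "bernoulli.indep_vars (bernoulli_factor p) (\<lambda>k \<omega>. \<omega> k) UNIV"
    by (subst bernoulli.indep_vars_iff_distr_eq_PiM
        [OF UNIV_not_empty bernoulli_space_projection_measurable])
  then have "bernoulli.indep_vars (bernoulli_factor p) (\<lambda>k \<omega>. \<omega> k) A"
    by (rule bernoulli.indep_vars_subset) simp
  then show ?thesis
    by (rule bernoulli.indep_vars_compose2) (rule bernoulli_factor_measurable)
qed

text \<open>A coordinate takes only two values, and the sum bounds both cases. This gives
  boundedness, hence integrability, of all products of coordinate functions below.\<close>

lemma component_bounded:
  assumes "\<omega> \<in> space (bernoulli_space p)"
  shows "\<bar>f (\<omega> k)\<bar> \<le> \<bar>f (-1)\<bar> + \<bar>f 1 :: real\<bar>"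
proof -
  have "\<omega> k \<in> {-1, 1}"
    using assms by (auto simp: space_bernoulli_space)
  then show ?thesis
    by auto
qed

lemma Y_prod_L2: "Y_prod p A \<in> L2_space (bernoulli_space p)"
proof (rule bernoulli.L2_space_bounded[OF Y_prod_measurable])
  let ?g = "\<lambda>k x. (1 - 2 * p k + x) / (2 * sqrt (p k * (1 - p k)))"
  fix \<omega> assume "\<omega> \<in> space (bernoulli_space p)"
  then show "\<bar>Y_prod p A \<omega>\<bar> \<le> (\<Prod>k\<in>A. \<bar>?g k (-1)\<bar> + \<bar>?g k 1\<bar>)"
    unfolding Y_prod_def abs_prod Y_eq
    by (intro prod_mono conjI component_bounded[where f = "?g k" for k]) simp_all
qed

lemma Y_prod_orthogonal:
  assumes "finite A" "finite B" "A \<noteq> B"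
  shows "L2_inner (bernoulli_space p) (Y_prod p A) (Y_prod p B) = 0"
proof -
  let ?g = "\<lambda>k x. (1 - 2 * p k + x) / (2 * sqrt (p k * (1 - p k)))"
  \<comment> \<open>On \<open>A \<union> B\<close>, \<open>h k\<close> is the square of
    \<open>Y\<^sub>k\<close> if \<open>k\<close> lies in both sets and \<open>Y\<^sub>k\<close> if
    it lies in exactly one. The integrand is thus a product of functions of separate
    coordinates.\<close>
  define h where "h k x = (if k \<in> A then ?g k x else 1) * (if k \<in> B then ?g k x else 1)" for k x
  have "Y_prod p A \<omega> * Y_prod p B \<omega> = (\<Prod>k\<in>A \<union> B. h k (\<omega> k))" for \<omega>
  proof -
    have "(\<Prod>k\<in>A \<union> B. h k (\<omega> k)) =
        (\<Prod>k\<in>A \<union> B. if k \<in> A then Y p k \<omega> else 1) * (\<Prod>k\<in>A \<union> B. if k \<in> B then Y p k \<omega> else 1)"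
      unfolding h_def Y_eq prod.distrib ..
    also have "\<dots> = Y_prod p A \<omega> * Y_prod p B \<omega>"
      unfolding Y_prod_def using assms
      by (intro arg_cong2[where f = "(*)"] prod.mono_neutral_cong_right) auto
    finally show ?thesis
      by simp
  qed
  then have "L2_inner (bernoulli_space p) (Y_prod p A) (Y_prod p B) =
      (LINT \<omega>|bernoulli_space p. (\<Prod>k\<in>A \<union> B. h k (\<omega> k)))"
    by (simp add: L2_inner_def)
  also have "\<dots> = (\<Prod>k\<in>A \<union> B. LINT \<omega>|bernoulli_space p. h k (\<omega> k))"
  proof (rule bernoulli.indep_vars_lebesgue_integral[OF _ indep_vars_components[of h]])
    show "integrable (bernoulli_space p) (\<lambda>\<omega>. h k (\<omega> k))" for k
    proof (rule bernoulli.integrable_const_bound)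
      show "AE \<omega> in bernoulli_space p. norm (h k (\<omega> k)) \<le> \<bar>h k (-1)\<bar> + \<bar>h k 1\<bar>"
        using component_bounded[where f = "h k"] by (intro AE_I2) simp
    qed (rule bernoulli_space_component_measurable)
  qed (use assms in simp)
  also have "\<dots> = 0"
  proof -
    \<comment> \<open>An index in the symmetric difference contributes the factor
      \<open>E[Y\<^sub>k] = 0\<close>.\<close>
    obtain k where k: "k \<in> A \<union> B" "k \<in> A \<longleftrightarrow> k \<notin> B"
      using assms by blast
    then have "h k (\<omega> k) = Y p k \<omega>" for \<omega>
      by (auto simp: h_def Y_eq)
    then have "(LINT \<omega>|bernoulli_space p. h k (\<omega> k)) = 0"
      by (simp add: expectation_Y)
    with k assms show ?thesis
      by (intro prod_zero) auto
  qed
  finally show ?thesis .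
qed

section \<open>The chaos decomposition\<close>

text \<open>This lets degree 0, defined separately through almost surely constant functions, be
  treated like the others: the only 0-tuple is \<open>[]\<close>, and its empty product is
  1.\<close>

lemma chaos_is_J:
  assumes "F \<in> chaos p n"
  obtains f where "is_J p n f F"
proof (cases "n = 0")
  case False
  with assms that show ?thesis
    by (auto simp: chaos_def)
next
  case True
  with assms obtain c where F: "F \<in> L2_space (bernoulli_space p)"
    and c: "AE \<omega> in bernoulli_space p. F \<omega> = c"
    by (auto simp: chaos_def)
  have "L2_norm (bernoulli_space p) (\<lambda>\<omega>. F \<omega> - c) = 0"
  proof -
    have "(LINT \<omega>|bernoulli_space p. (F \<omega> - c) * (F \<omega> - c)) = 0"
      using c by (intro integral_eq_zero_AE) auto
    then show ?thesis
      by (simp add: L2_norm_def L2_inner_def)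
  qed
  \<comment> \<open>On a finite index set the filter is principal at the full set, so only the
    complete sum, here the constant \<open>c\<close>, matters.\<close>
  then have "((\<lambda>I. L2_norm (bernoulli_space p) (\<lambda>\<omega>. F \<omega> - (\<Sum>ks\<in>I. c * (\<Prod>i<0. Y p (ks ! i) \<omega>))))
      \<longlongrightarrow> 0) (finite_subsets_at_top {[]})"
    by (intro tendsto_eventually) (simp add: finite_subsets_at_top_finite eventually_principal)
  moreover have "\<Delta> 0 = {[]}"
    by (auto simp: \<Delta>_eq)
  ultimately have "is_J p 0 (\<lambda>_. c) F"
    using F by (simp only: is_J_def has_L2_sum_def simp_thms)
  with True that show ?thesis
    by blast
qed

lemma is_J_summand_L2:
  assumes "ks \<in> \<Delta> n"
  shows "(\<lambda>\<omega>. c * (\<Prod>i<n. Y p (ks ! i) \<omega>)) \<in> L2_space (bernoulli_space p)"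
  using L2_space_scale[OF Y_prod_L2] by (simp add: prod_Y_eq_Y_prod[OF assms])

text \<open>Orthogonality passes to L2 sums in each argument: expanding \<open>F\<close> first and
  then \<open>G\<close> reduces the claim to a pair of products \<open>Y\<^sub>A\<close>.\<close>

lemma is_J_orthogonal:
  assumes "m \<noteq> n" "is_J p m f F" "is_J p n g G"
  shows "L2_inner (bernoulli_space p) F G = 0"
proof (rule has_L2_sum_orthogonal[OF assms(2)[unfolded is_J_def] _ is_J_summand_L2])
  show "G \<in> L2_space (bernoulli_space p)"
    using assms(3) by (simp add: is_J_def has_L2_sum_def)
  fix ks assume ks: "ks \<in> \<Delta> m"
  let ?u = "\<lambda>\<omega>. f ks * (\<Prod>i<m. Y p (ks ! i) \<omega>)"
  have "L2_inner (bernoulli_space p) G ?u = 0"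
  proof (rule has_L2_sum_orthogonal[OF assms(3)[unfolded is_J_def] is_J_summand_L2[OF ks]
        is_J_summand_L2])
    fix ls assume ls: "ls \<in> \<Delta> n"
    \<comment> \<open>Tuples with distinct entries have as many entries as their length, so these
      sets have cardinalities \<open>n\<close> and \<open>m\<close>.\<close>
    have "set ls \<noteq> set ks"
      using ks ls \<open>m \<noteq> n\<close> distinct_card[of ks] distinct_card[of ls] by (auto simp: \<Delta>_eq)
    then have "L2_inner (bernoulli_space p) (Y_prod p (set ls)) (Y_prod p (set ks)) = 0"
      by (simp add: Y_prod_orthogonal)
    moreover have "L2_inner (bernoulli_space p) (\<lambda>\<omega>. g ls * Y_prod p (set ls) \<omega>)
        (\<lambda>\<omega>. f ks * Y_prod p (set ks) \<omega>) =
        (g ls * f ks) * L2_inner (bernoulli_space p) (Y_prod p (set ls)) (Y_prod p (set ks))"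
      unfolding L2_inner_def integral_mult_right_zero[symmetric]
      by (rule Bochner_Integration.integral_cong) simp_all
    ultimately show "L2_inner (bernoulli_space p) (\<lambda>\<omega>. g ls * (\<Prod>i<n. Y p (ls ! i) \<omega>)) ?u = 0"
      by (simp add: prod_Y_eq_Y_prod[OF ks] prod_Y_eq_Y_prod[OF ls])
  qed
  then show "L2_inner (bernoulli_space p) ?u G = 0"
    by (simp add: L2_inner_commute)
qed

section \<open>Density of the span of the chaoses\<close>

lemma chaos_L2: "chaos p n \<subseteq> L2_space (bernoulli_space p)"
  by (auto simp: chaos_def is_J_def has_L2_sum_def)

text \<open>The kernel is the normalised indicator of the orderings of \<open>B\<close>.\<close>

lemma Y_prod_in_chaos:
  assumes "finite B"
  shows "Y_prod p B \<in> chaos p (card B)"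
proof (cases "B = {}")
  case True
  then show ?thesis
    using Y_prod_L2[of B] by (auto simp: chaos_def Y_prod_def)
next
  case False
  define n where "n = card B"
  have n: "n \<noteq> 0"
    using False assms by (simp add: n_def)
  define T where "T = {ks. length ks = n \<and> set ks = B}"
  define f where "f ks = (if ks \<in> T then 1 / real (card T) else 0)" for ks
  have finT: "finite T"
    unfolding T_def by (rule finite_lists_with_set)
  obtain bs where "set bs = B" "distinct bs"
    using finite_distinct_list[OF assms] by blast
  then have "bs \<in> T"
    by (auto simp: T_def n_def distinct_card)
  then have T: "card T \<noteq> 0"
    using finT by auto
  \<comment> \<open>A list whose length equals the cardinality of its set has no
    repetitions.\<close>
  have T\<Delta>: "T \<subseteq> \<Delta> n"
    by (auto simp: T_def \<Delta>_eq n_def intro: card_distinct)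
  have "f \<in> sym_l2 n"
  proof -
    have "(\<lambda>ks. (f ks)\<^sup>2) summable_on {ks. length ks = n}"
    proof (rule summable_on_cong_neutral[THEN iffD1])
      show "(\<lambda>ks. (f ks)\<^sup>2) summable_on T"
        using finT by (rule summable_on_finite)
    qed (auto simp: f_def T_def)
    \<comment> \<open>Permuting preserves length and set of entries, hence membership in
      \<open>T\<close>.\<close>
    moreover have "f (permute_list \<pi> ks) = f ks" if "length ks = n" "\<pi> permutes {..<n}" for ks \<pi>
      using that by (simp add: f_def T_def)
    ultimately show ?thesis
      by (simp add: sym_l2_def)
  qed
  moreover have "is_J p n f (Y_prod p B)"
    unfolding is_J_def has_L2_sum_def
  proof (intro conjI Y_prod_L2)
    \<comment> \<open>As soon as \<open>I\<close> contains \<open>T\<close>, the partial sum is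
      exactly \<open>Y\<^sub>B\<close>: terms outside \<open>T\<close> vanish, and those in
      \<open>T\<close> are equal with total weight 1. The error is therefore eventually 0.\<close>
    have "(\<Sum>ks\<in>I. f ks * (\<Prod>i<n. Y p (ks ! i) \<omega>)) = Y_prod p B \<omega>"
      if I: "finite I" "T \<subseteq> I" "I \<subseteq> \<Delta> n" for I \<omega>
    proof -
      have "(\<Sum>ks\<in>I. f ks * (\<Prod>i<n. Y p (ks ! i) \<omega>)) = (\<Sum>ks\<in>T. 1 / real (card T) * Y_prod p B \<omega>)"
        using I T\<Delta> by (intro sum.mono_neutral_cong_right)
          (auto simp: f_def T_def prod_Y_eq_Y_prod subset_iff)
      also have "\<dots> = Y_prod p B \<omega>"
        using T by simp
      finally show ?thesis .
    qed
    then have "\<forall>\<^sub>F I in finite_subsets_at_top (\<Delta> n). L2_norm (bernoulli_space p)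
        (\<lambda>\<omega>. Y_prod p B \<omega> - (\<Sum>ks\<in>I. f ks * (\<Prod>i<n. Y p (ks ! i) \<omega>))) = 0"
      unfolding eventually_finite_subsets_at_top using finT T\<Delta>
      by (intro exI[of _ T]) (auto simp: L2_norm_zero)
    then show "((\<lambda>I. L2_norm (bernoulli_space p)
        (\<lambda>\<omega>. Y_prod p B \<omega> - (\<Sum>ks\<in>I. f ks * (\<Prod>i<n. Y p (ks ! i) \<omega>)))) \<longlongrightarrow> 0)
        (finite_subsets_at_top (\<Delta> n))"
      by (rule tendsto_eventually)
  qed
  ultimately show ?thesis
    using n by (auto simp: chaos_def n_def)
qed

lemma cylinder_in_closure:
  assumes A: "A \<in> prod_algebra UNIV (bernoulli_factor p)"
  shows "indicator A \<in> L2_closure (bernoulli_space p) (real_fun_span (\<Union>n. chaos p n))"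
    (is "_ \<in> L2_closure ?M ?S")
proof -
  have sub: "real_fun.subspace ?S"
    by (rule real_fun.subspace_span)
  have SL2: "?S \<subseteq> L2_space ?M"
    using chaos_L2 by (intro real_fun.span_minimal subspace_L2_space) auto
  have Y: "Y_prod p B \<in> L2_closure ?M ?S" if "finite B" for B
    using Y_prod_in_chaos[OF that] L2_closure_incl[OF SL2] by (blast intro: real_fun.span_base)
  from A obtain J E where A: "A = prod_emb UNIV (bernoulli_factor p) J (\<Pi>\<^sub>E j\<in>J. E j)"
    and J: "finite J"
    by (rule prod_algebraE)
  \<comment> \<open>\<open>s k\<close> is the denominator of \<open>Y\<^sub>k\<close>. The indicator
    of \<open>E k\<close> on {-1, 1} is its mean over the two points plus
    \<open>b k * \<omega> k\<close>; substituting
    \<open>\<omega> k = s k * Y p k \<omega> - (1 - 2 * p k)\<close> gives slope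
    \<open>b k * s k\<close> and intercept \<open>a k\<close>.\<close>
  define s where "s k = 2 * sqrt (p k * (1 - p k))" for k
  define b where "b k = (indicator (E k) 1 - indicator (E k) (-1) :: real) / 2" for k
  define a where "a k = (indicator (E k) 1 + indicator (E k) (-1)) / 2 - b k * (1 - 2 * p k)" for k
  have "(\<lambda>\<omega>. \<Sum>B\<in>Pow J. ((\<Prod>k\<in>B. b k * s k) * (\<Prod>k\<in>J - B. a k)) * Y_prod p B \<omega>) \<in> L2_closure ?M ?S"
    using J by (intro L2_closure_sum[OF sub SL2] L2_closure_scale[OF sub SL2] Y)
      (auto intro: finite_subset)
  then show ?thesis
  proof (rule L2_closure_cong[OF sub SL2])
    fix \<omega> assume \<omega>: "\<omega> \<in> space ?M"
    have ind: "indicator (E k) (\<omega> k) = b k * s k * Y p k \<omega> + a k" for k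
    proof -
      have "s k \<noteq> 0"
        using p[of k] by (simp add: s_def)
      then have "b k * s k * Y p k \<omega> = b k * (1 - 2 * p k + \<omega> k)"
        by (simp add: Y_eq flip: s_def)
      then have "b k * s k * Y p k \<omega> + a k = (indicator (E k) 1 + indicator (E k) (-1)) / 2 + b k * \<omega> k"
        by (simp add: a_def algebra_simps)
      moreover have "\<omega> k \<in> {-1, 1}"
        using \<omega> by (auto simp: space_bernoulli_space)
      ultimately show ?thesis
        by (auto simp: b_def field_simps)
    qed
    have "\<omega> \<in> A \<longleftrightarrow> (\<forall>k\<in>J. \<omega> k \<in> E k)"
      using \<omega> by (auto simp: A prod_emb_iff space_bernoulli_space space_point_measure Pi_iff)
    then have "indicator A \<omega> = (\<Prod>k\<in>J. indicator (E k) (\<omega> k) :: real)"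
      using J by (auto simp: indicator_def)
    \<comment> \<open>Multiplying out, \<open>B\<close> collects the indices at which the term with
      \<open>Y\<^sub>k\<close> is chosen.\<close>
    also have "\<dots> = (\<Sum>B\<in>Pow J. (\<Prod>k\<in>B. b k * s k * Y p k \<omega>) * (\<Prod>k\<in>J - B. a k))"
      unfolding ind by (rule prod_add[OF J])
    also have "\<dots> = (\<Sum>B\<in>Pow J. ((\<Prod>k\<in>B. b k * s k) * (\<Prod>k\<in>J - B. a k)) * Y_prod p B \<omega>)"
      by (simp add: Y_prod_def prod.distrib mult_ac)
    finally show "indicator A \<omega> =
        (\<Sum>B\<in>Pow J. ((\<Prod>k\<in>B. b k * s k) * (\<Prod>k\<in>J - B. a k)) * Y_prod p B \<omega>)" .
  qed
qed

lemma L2_space_subset_closure_chaos: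
  "L2_space (bernoulli_space p) \<subseteq>
     L2_closure (bernoulli_space p) (real_fun_span (\<Union>n. chaos p n))"
proof (rule L2_space_subset_closure_if_generator)
  show "real_fun.subspace (real_fun_span (\<Union>n. chaos p n))"
    by (rule real_fun.subspace_span)
  show SL2: "real_fun_span (\<Union>n. chaos p n) \<subseteq> L2_space (bernoulli_space p)"
    using chaos_L2 by (intro real_fun.span_minimal subspace_L2_space) auto
  show "finite_measure (bernoulli_space p)"
    by (rule bernoulli.finite_measure_axioms)
  show "sets (bernoulli_space p) =
      sigma_sets (space (bernoulli_space p)) (prod_algebra UNIV (bernoulli_factor p))"
    by (simp add: bernoulli_space_def sets_PiM space_PiM)
  \<comment> \<open>The constant 1 is the empty product, an element of the chaos of degree
    0.\<close>
  show "(\<lambda>\<omega>. 1) \<in> L2_closure (bernoulli_space p) (real_fun_span (\<Union>n. chaos p n))"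
    using Y_prod_in_chaos[of "{}"] L2_closure_incl[OF SL2]
    by (auto simp: Y_prod_def[abs_def] intro: real_fun.span_base)
qed (rule Int_stable_prod_algebra cylinder_in_closure; assumption?)+

end

theorem proposition6p7:
  fixes p :: "nat \<Rightarrow> real"
  assumes "\<And>k. 0 < p k \<and> p k < 1"
  shows "(\<forall>m n. m \<noteq> n \<longrightarrow>
            (\<forall>F\<in>chaos p m. \<forall>G\<in>chaos p n. L2_inner (bernoulli_space p) F G = 0)) \<and>
         L2_space (bernoulli_space p) =
           L2_closure (bernoulli_space p) (real_fun_span (\<Union>n. chaos p n))"
\<comment> \<open>The closure lies in L2 by definition, so orthogonality and density remain.\<close>
proof (intro conjI allI impI ballI subset_antisym L2_closure_subset)
  fix m n :: nat and F G
  assume "m \<noteq> n" "F \<in> chaos p m" "G \<in> chaos p n"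
  then show "L2_inner (bernoulli_space p) F G = 0"
    by (auto elim!: chaos_is_J[OF assms] intro: is_J_orthogonal[OF assms])
qed (rule L2_space_subset_closure_chaos[OF assms])

end
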